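(* Let $X$ be a compact metric space and $f\colon X\to X$ a continuous map with the shadowing property. If $\dim X=0$, then $\mathcal{C}(f)=\overline{\mathcal{C}_{sh}(f)}$, i.e., $\mathcal{C}_{sh}(f)$ is dense in $\mathcal{C}(f)$.
   Context: A $\delta$-chain of $f$ is a finite sequence $(x_i)_{i=0}^k$, $k>0$, with $d(f(x_i),x_{i+1})\le\delta$ for all $0\le i<k$; write $x\to_{f,\delta}y$ if there is one with $x_0=x$, $x_k=y$. $CR(f)$ is the set of $x$ with $x\to_{f,\delta}x$ for all $\delta>0$. For $x,y\in CR(f)$, $x\leftrightarrow_f y$ iff $x\to_{f,\delta}y$ and $y\to_{f,\delta}x$ for all $\delta>0$; this is a closed equivalence relation on $CR(f)$ whose classes are the chain components, and $\mathcal{C}(f)=CR(f)/\leftrightarrow_f$ is the set of chain components endowed with the quotient topology (a compact metrizable space). Each chain component $C$ is closed and $f$-invariant. $f$ has the shadowing property if for every $\epsilon>0$ there is $\delta>0$ such that for every sequence $(x_i)_{i\ge0}$ with $d(f(x_i),x_{i+1})\le\delta$ for all $i$ there is $x$ with $d(f^i(x),x_i)\le\epsilon$ for all $i$. $\mathcal{C}_{sh}(f)=\{C\in\mathcal{C}(f): f|_C\colon C\to C$ has the shadowing property$\}$. *)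

theory Defs
  imports "HOL-Analysis.Analysis"
begin

text \<open>The phase space X is a set S in a metric space; f is viewed on S.\<close>

definition chain_to :: "'a::metric_space set \<Rightarrow> ('a \<Rightarrow> 'a) \<Rightarrow> real \<Rightarrow> 'a \<Rightarrow> 'a \<Rightarrow> bool" where
  "chain_to S f \<delta> x y \<longleftrightarrow>
     (\<exists>k::nat. \<exists>xs::nat \<Rightarrow> 'a. k > 0 \<and> (\<forall>i\<le>k. xs i \<in> S) \<and> xs 0 = x \<and> xs k = y \<and>
        (\<forall>i<k. dist (f (xs i)) (xs (Suc i)) \<le> \<delta>))"

definition chain_recurrent :: "'a::metric_space set \<Rightarrow> ('a \<Rightarrow> 'a) \<Rightarrow> 'a set" where
  "chain_recurrent S f = {x \<in> S. \<forall>\<delta>>0. chain_to S f \<delta> x x}"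

definition chain_equiv :: "'a::metric_space set \<Rightarrow> ('a \<Rightarrow> 'a) \<Rightarrow> ('a \<times> 'a) set" where
  "chain_equiv S f = {(x, y). x \<in> chain_recurrent S f \<and> y \<in> chain_recurrent S f \<and>
       (\<forall>\<delta>>0. chain_to S f \<delta> x y \<and> chain_to S f \<delta> y x)}"

definition chain_components :: "'a::metric_space set \<Rightarrow> ('a \<Rightarrow> 'a) \<Rightarrow> 'a set set" where
  "chain_components S f = chain_recurrent S f // chain_equiv S f"

text \<open>Quotient topology on the chain components: a set of components is open iff its
  union is open in CR(f) (with the subspace topology from X).\<close>
definition chain_components_topology :: "'a::metric_space set \<Rightarrow> ('a \<Rightarrow> 'a) \<Rightarrow> 'a set topology" where
  "chain_components_topology S f =
     topology (\<lambda>U. U \<subseteq> chain_components S f \<and>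
                   openin (top_of_set (chain_recurrent S f)) (\<Union>U))"

definition shadowing :: "'a::metric_space set \<Rightarrow> ('a \<Rightarrow> 'a) \<Rightarrow> bool" where
  "shadowing S f \<longleftrightarrow>
     (\<forall>\<epsilon>>0. \<exists>\<delta>>0. \<forall>xs::nat \<Rightarrow> 'a. (\<forall>i. xs i \<in> S) \<and> (\<forall>i. dist (f (xs i)) (xs (Suc i)) \<le> \<delta>)
         \<longrightarrow> (\<exists>x\<in>S. \<forall>i. dist ((f ^^ i) x) (xs i) \<le> \<epsilon>))"

definition shadowing_components :: "'a::metric_space set \<Rightarrow> ('a \<Rightarrow> 'a) \<Rightarrow> 'a set set" where
  "shadowing_components S f = {C \<in> chain_components S f. shadowing C f}"

text \<open>Zero-dimensionality (small inductive dimension 0): S has a base of clopen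
  (relatively open and closed) subsets.\<close>
definition zero_dimensional :: "'a::metric_space set \<Rightarrow> bool" where
  "zero_dimensional S \<longleftrightarrow>
     (\<forall>x\<in>S. \<forall>U. openin (top_of_set S) U \<and> x \<in> U \<longrightarrow>
        (\<exists>V. openin (top_of_set S) V \<and> closedin (top_of_set S) V \<and> x \<in> V \<and> V \<subseteq> U))"

end

theory Submission
  imports Defs
begin

text \<open>Label the points of \<open>S\<close> by a refining sequence of finite clopen partitions \<open>p n\<close> such that every
  pseudo-orbit of precision \<open>p (n + 1)\<close> is shadowed with precision \<open>p n\<close>. At each level the points
  that can be joined by pseudo-orbits in both directions form finitely many clopen classes, and the chain
  components are the intersections of nested sequences of classes. A periodic pseudo-orbit running through
  many words of a class is shadowed by a true orbit, which eventually stays in one class of a finer level;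
  so the \<open>p n\<close>-words of a class survive in a class of the next level. Descending through classes whose
  sets of words are maximal, one reaches, inside any given class, a chain component \<open>D\<close> in which no word
  gets lost: each \<open>p n\<close>-word of a fine pseudo-orbit in \<open>D\<close> occurs in classes of every level, and
  shadowing in \<open>S\<close> followed by compactness produces a true orbit in \<open>D\<close> that follows it.\<close>

section \<open>Preliminaries on lists and nested compact sets\<close>

lemma successively_iff_nth:
  "successively P xs \<longleftrightarrow> (\<forall>i. Suc i < length xs \<longrightarrow> P (xs ! i) (xs ! Suc i))"
proof (induction P xs rule: successively.induct)
  case (3 P x y xs)
  have "(\<forall>i. Q i) \<longleftrightarrow> Q 0 \<and> (\<forall>i. Q (Suc i))" for Q
  proof safe
    show "Q i" if "Q 0" "\<forall>i. Q (Suc i)" for i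
      using that by (cases i) auto
  qed auto
  from this[of "\<lambda>i. Suc i < length (x # y # xs) \<longrightarrow> P ((x # y # xs) ! i) ((x # y # xs) ! Suc i)"]
  show ?case
    using 3 by simp
qed auto

text \<open>The finite intersection property holds because, among finitely many members, the one of
  largest index lies in all the others.\<close>

lemma nested_compact_Inter_nonempty:
  fixes F :: "nat \<Rightarrow> 'a::t2_space set"
  assumes "\<And>n. compact (F n)" "\<And>n. F n \<noteq> {}" "\<And>n. F (Suc n) \<subseteq> F n"
  shows "\<Inter>(range F) \<noteq> {}"
proof -
  have mono: "F n \<subseteq> F m" if "m \<le> n" for m n
    using assms(3) that by (rule lift_Suc_antimono_le)
  have "F 0 \<inter> \<Inter>(F ` UNIV) \<noteq> {}"
  proof (rule compact_imp_fip_image)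
    show "F 0 \<inter> \<Inter>(F ` I) \<noteq> {}" if "finite I" for I
    proof -
      have "F (Max (insert 0 I)) \<subseteq> F i" if "i \<in> insert 0 I" for i
        using that \<open>finite I\<close> by (intro mono Max_ge) auto
      then have "F (Max (insert 0 I)) \<subseteq> F 0 \<inter> \<Inter>(F ` I)"
        by blast
      then show ?thesis
        using assms(2) by blast
    qed
  qed (use assms(1) compact_imp_closed in auto)
  then show ?thesis
    by auto
qed

section \<open>Pseudo-orbits and classes for a sequence of labellings\<close>

text \<open>Closeness of points is replaced by equality of labels: \<open>locally_constant\<close>
  and \<open>mesh\<close> translate between the two, and \<open>shadow\<close> costs one level of
  precision, from \<open>Suc n\<close> down to \<open>n\<close>.\<close>

locale shadowing_partitions =
  fixes S :: "'a::metric_space set" and f :: "'a \<Rightarrow> 'a" and p :: "nat \<Rightarrow> 'a \<Rightarrow> 'b"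
  assumes compact: "compact S"
    and invariant: "f ` S \<subseteq> S"
    and continuous: "continuous_on S f"
    and finite_labels: "finite (p n ` S)"
    and refine: "\<lbrakk>x \<in> S; y \<in> S; p (Suc n) x = p (Suc n) y\<rbrakk> \<Longrightarrow> p n x = p n y"
    and locally_constant: "\<exists>\<delta>>0. \<forall>x\<in>S. \<forall>y\<in>S. dist x y \<le> \<delta> \<longrightarrow> p n x = p n y"
    and mesh: "\<epsilon> > 0 \<Longrightarrow> \<exists>n. \<forall>x\<in>S. \<forall>y\<in>S. p n x = p n y \<longrightarrow> dist x y \<le> \<epsilon>"
    and shadow: "\<lbrakk>\<forall>i. xs i \<in> S; \<forall>i. p (Suc n) (f (xs i)) = p (Suc n) (xs (Suc i))\<rbrakk>
      \<Longrightarrow> \<exists>z\<in>S. \<forall>i. p n ((f ^^ i) z) = p n (xs i)"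
begin

text \<open>Only the target of a step is fuzzy, so reachability depends on the source \<open>x\<close> through the label of
  \<open>f x\<close>; classes are therefore determined by the labels of \<open>x\<close> and \<open>f x\<close>, not by that of \<open>x\<close> alone.\<close>

definition step :: "nat \<Rightarrow> 'a \<Rightarrow> 'a \<Rightarrow> bool" where
  "step n x y \<longleftrightarrow> x \<in> S \<and> y \<in> S \<and> p n (f x) = p n y"

abbreviation reach :: "nat \<Rightarrow> 'a \<Rightarrow> 'a \<Rightarrow> bool" where
  "reach n \<equiv> (step n)\<^sup>+\<^sup>+"

text \<open>The strongly connected component of \<open>x\<close> in the graph of
  \<open>step n\<close>. It is empty if \<open>x\<close> lies on no closed walk, so
  \<open>x \<in> cls n x\<close> says that \<open>x\<close> is recurrent at level
  \<open>n\<close>.\<close>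

definition cls :: "nat \<Rightarrow> 'a \<Rightarrow> 'a set" where
  "cls n x = {y. reach n x y \<and> reach n y x}"

definition walk :: "nat \<Rightarrow> 'a set \<Rightarrow> 'a list \<Rightarrow> bool" where
  "walk n K xs \<longleftrightarrow> set xs \<subseteq> K \<and> successively (step n) xs"

text \<open>Two precisions are kept apart: \<open>n\<close> governs the steps, \<open>k\<close> the
  labels that are read off. Words of classes of different levels thus become comparable.\<close>

definition lang :: "nat \<Rightarrow> nat \<Rightarrow> 'a set \<Rightarrow> 'b list set" where
  "lang k n K = map (p k) ` {xs. walk n K xs}"

lemma f_in: "x \<in> S \<Longrightarrow> f x \<in> S"
  using invariant by auto

lemma funpow_in: "x \<in> S \<Longrightarrow> (f ^^ i) x \<in> S"
  by (induction i) (auto simp: f_in)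

lemma reach_in: "reach n x y \<Longrightarrow> x \<in> S \<and> y \<in> S"
  by (induction rule: tranclp_induct) (auto simp: step_def)

lemma cls_in: "y \<in> cls n x \<Longrightarrow> x \<in> S \<and> y \<in> S"
  unfolding cls_def using reach_in by blast

lemma cls_subset: "cls n x \<subseteq> S"
  using cls_in by blast

lemma step_f: "x \<in> S \<Longrightarrow> step n x (f x)"
  by (simp add: step_def f_in)

lemma reach_source:
  assumes "reach n x y" "x' \<in> S" "p n (f x') = p n (f x)"
  shows "reach n x' y"
proof -
  obtain z where "step n x z" "(step n)\<^sup>*\<^sup>* z y"
    using tranclpD[OF assms(1)] by blast
  then show ?thesis
    using assms(2,3) by (auto simp: step_def intro: rtranclp_into_tranclp2)
qed

lemma reach_target:
  assumes "reach n x y" "y' \<in> S" "p n y' = p n y"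
  shows "reach n x y'"
proof -
  obtain z where "step n z y" "(step n)\<^sup>*\<^sup>* x z"
    using assms(1) by (cases rule: tranclp.cases) (auto dest: tranclp_into_rtranclp)
  then show ?thesis
    using assms(2,3) by (auto simp: step_def intro: rtranclp_into_tranclp1)
qed

lemma refine_le:
  assumes "m \<le> n" "x \<in> S" "y \<in> S" "p n x = p n y"
  shows "p m x = p m y"
  using assms by (induction rule: inc_induct) (auto intro: refine)

lemma step_antimono: "m \<le> n \<Longrightarrow> step n x y \<Longrightarrow> step m x y"
  unfolding step_def using refine_le f_in by blast

lemma reach_antimono: "m \<le> n \<Longrightarrow> reach n x y \<Longrightarrow> reach m x y"
proof -
  assume "reach n x y" "m \<le> n"
  then show "reach m x y"
    by (induction rule: tranclp_induct) (auto dest: step_antimono intro: tranclp.intros)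
qed

lemma cls_antimono: "m \<le> n \<Longrightarrow> cls n x \<subseteq> cls m x"
  unfolding cls_def using reach_antimono by blast

lemma cls_sym: "y \<in> cls n x \<longleftrightarrow> x \<in> cls n y"
  unfolding cls_def by blast

lemma cls_eq: "y \<in> cls n x \<Longrightarrow> cls n y = cls n x"
  unfolding cls_def by (blast intro: tranclp_trans)

lemma cls_self: "y \<in> cls n x \<Longrightarrow> y \<in> cls n y"
  unfolding cls_def by (blast intro: tranclp_trans)

lemma cls_cong:
  assumes "y \<in> cls n x" "y' \<in> S" "p n y' = p n y" "p n (f y') = p n (f y)"
  shows "y' \<in> cls n x"
  using assms unfolding cls_def by (auto intro: reach_source reach_target)

text \<open>The pair of labels of \<open>x\<close> and \<open>f x\<close> determines the class and
  takes only finitely many values.\<close>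

lemma finite_cls: "finite (cls n ` S)"
proof -
  define c where "c x = (p n x, p n (f x))" for x
  have "c ` S \<subseteq> p n ` S \<times> p n ` S"
    using f_in by (auto simp: c_def)
  then have "finite (c ` S)"
    using finite_labels finite_subset by blast
  moreover have "cls n x = cls n (inv_into S c (c x))" if "x \<in> S" for x
  proof -
    define x' where "x' = inv_into S c (c x)"
    have "x' \<in> S" "c x' = c x"
      using that by (auto simp: x'_def inv_into_into f_inv_into_f)
    then have "cls n x' = cls n x"
      using that unfolding cls_def c_def
      by (auto intro: reach_source reach_target)
    then show ?thesis
      by (simp add: x'_def)
  qed
  then have "cls n ` S \<subseteq> (\<lambda>v. cls n (inv_into S c v)) ` c ` S"
    by blast
  ultimately show ?thesis
    using finite_surj by blast
qed

section \<open>Words and walks inside a class\<close>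

lemma lang_mono: "K \<subseteq> L \<Longrightarrow> n \<le> m \<Longrightarrow> lang k m K \<subseteq> lang k n L"
proof -
  assume "K \<subseteq> L" "n \<le> m"
  then have "walk n L xs" if "walk m K xs" for xs
    using that successively_mono[of "step m" xs "step n"] step_antimono[of n m]
    unfolding walk_def by blast
  then show "lang k m K \<subseteq> lang k n L"
    unfolding lang_def by blast
qed

text \<open>On \<open>S\<close> the label of level \<open>j\<close> is a function of the label of
  level \<open>k\<close>; applying it letter by letter turns the given inclusion into the coarser
  one.\<close>

lemma lang_coarsen:
  assumes "lang k n K \<subseteq> lang k m L" "j \<le> k" "K \<subseteq> S" "L \<subseteq> S"
  shows "lang j n K \<subseteq> lang j m L"
proof -
  define \<phi> where "\<phi> v = p j (inv_into S (p k) v)" for v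
  have \<phi>: "\<phi> (p k x) = p j x" if "x \<in> S" for x
    unfolding \<phi>_def using that
    by (intro refine_le[OF assms(2)]) (auto simp: inv_into_into f_inv_into_f)
  have "lang j n' M = map \<phi> ` lang k n' M" if "M \<subseteq> S" for n' M
    unfolding lang_def image_image
    by (rule image_cong) (use that \<phi> in \<open>auto simp: walk_def\<close>)
  then show ?thesis
    using image_mono[OF assms(1), of "map \<phi>"] assms(3,4) by simp
qed

text \<open>The reachability of the inner points is carried along so that the path can later be seen
  to stay in the class of its ends.\<close>

lemma reach_path:
  assumes "reach n a b"
  shows "\<exists>ps. successively (step n) (a # ps @ [b]) \<and> (\<forall>c\<in>set ps. reach n a c \<and> reach n c b)"
  using assms
proof (induction rule: tranclp_induct)
  case (base y)
  then show ?case
    by (intro exI[of _ "[]"]) auto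
next
  case (step y z)
  then obtain ps where ps: "successively (step n) (a # ps @ [y])"
    "\<forall>c\<in>set ps. reach n a c \<and> reach n c y"
    by blast
  show ?case
  proof (intro exI conjI)
    show "successively (step n) (a # (ps @ [y]) @ [z])"
      using ps(1) step(2) successively_append_iff[of "step n" "a # ps @ [y]" "[z]"] by simp
    show "\<forall>c\<in>set (ps @ [y]). reach n a c \<and> reach n c z"
      using ps(2) step(1,2) by (auto intro: tranclp.trancl_into_trancl)
  qed
qed

lemma cls_path:
  assumes "a \<in> cls n x" "b \<in> cls n x"
  shows "\<exists>ps. walk n (cls n x) (a # ps @ [b])"
proof -
  have "reach n a b"
    using assms unfolding cls_def by (blast intro: tranclp_trans)
  from reach_path[OF this] obtain ps where "successively (step n) (a # ps @ [b])"
    "\<forall>c\<in>set ps. reach n a c \<and> reach n c b"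
    by blast
  moreover from this(2) have "set ps \<subseteq> cls n x"
    using assms unfolding cls_def by (blast intro: tranclp_trans)
  ultimately show ?thesis
    using assms unfolding walk_def by auto
qed

text \<open>Words are inserted one at a time: a loop at \<open>x\<close> that leads to the head of
  the word, through it, and back from its last point is appended. The final \<open>x\<close> is left
  out of \<open>us\<close>, so that \<open>us\<close> can be repeated periodically.\<close>

lemma closed_walk_through_finitely_many:
  assumes "finite W" "\<forall>w\<in>W. walk n (cls n x) w" "x \<in> cls n x"
  shows "\<exists>us. us \<noteq> [] \<and> hd us = x \<and> walk n (cls n x) (us @ [x]) \<and>
           (\<forall>w\<in>W. \<exists>as bs. us = as @ w @ bs)"
  using assms(1,2)
proof (induction W rule: finite_induct)
  case empty
  obtain ps where "walk n (cls n x) (x # ps @ [x])"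
    using cls_path assms(3) by blast
  then show ?case
    by (intro exI[of _ "x # ps"]) simp
next
  case (insert w W)
  then obtain us where us: "us \<noteq> []" "hd us = x" "walk n (cls n x) (us @ [x])"
    "\<forall>w\<in>W. \<exists>as bs. us = as @ w @ bs"
    by auto
  show ?case
  proof (cases "w = []")
    case True
    then have "us = us @ w @ []"
      by simp
    then have "\<forall>v\<in>insert w W. \<exists>as bs. us = as @ v @ bs"
      using us(4) by blast
    with us(1-3) show ?thesis
      by blast
  next
    case False
    have w: "walk n (cls n x) w"
      using insert by auto
    have "hd w \<in> cls n x" "last w \<in> cls n x"
      using w False by (auto simp: walk_def)
    then obtain as bs where as: "walk n (cls n x) (x # as @ [hd w])"
      and bs: "walk n (cls n x) (last w # bs @ [x])"
      using cls_path[OF assms(3)] cls_path[OF _ assms(3)] by blast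
    let ?vs = "us @ (x # as) @ w @ bs"
    have "walk n (cls n x) (x # as @ w @ bs @ [x])"
    proof -
      have "successively (step n) ((x # as) @ [hd w])" "successively (step n) (last w # (bs @ [x]))"
        using as bs by (simp_all add: walk_def)
      then have "successively (step n) ((x # as) @ w @ (bs @ [x]))"
        using w False unfolding walk_def successively_append_iff[of _ "x # as"]
          successively_append_iff[of _ w] successively_Cons[of _ "last w"]
        by simp
      then show ?thesis
        using as bs w by (simp add: walk_def)
    qed
    moreover have "walk n (cls n x) (us @ x # as @ w @ bs @ [x])" if "walk n (cls n x) (x # as @ w @ bs @ [x])"
      using us(3) that unfolding walk_def successively_append_iff[of _ us] by simp
    ultimately have "walk n (cls n x) (?vs @ [x])"
      by simp
    moreover have "\<exists>as' bs'. ?vs = as' @ v @ bs'" if "v \<in> insert w W" for v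
    proof (cases "v = w")
      case True
      then have "?vs = (us @ x # as) @ v @ bs"
        by simp
      then show ?thesis
        by blast
    next
      case False
      then have "v \<in> W"
        using that by simp
      with us(4) obtain as' bs' where "us = as' @ v @ bs'"
        by blast
      then have "?vs = as' @ v @ (bs' @ (x # as) @ w @ bs)"
        by simp
      then show ?thesis
        by blast
    qed
    moreover have "?vs \<noteq> []" "hd ?vs = x"
      using us(1,2) by simp_all
    ultimately show ?thesis
      by (intro exI[of _ ?vs]) blast
  qed
qed

section \<open>Descent from a class to one of the next level\<close>

text \<open>Some label recurs infinitely often along the orbit. If \<open>N\<close> is one of its
  times, every point of the orbit later meets that label again and hence reaches the point at time
  \<open>N\<close>.\<close>

lemma orbit_eventually_in_class:
  assumes "z \<in> S"
  shows "\<exists>N. \<forall>j\<ge>N. (f ^^ j) z \<in> cls n ((f ^^ N) z)"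
proof -
  have orbit: "reach n ((f ^^ i) z) ((f ^^ j) z)" if "i < j" for i j
    using that
  proof (induction rule: strict_inc_induct)
    case (base i)
    then show ?case
      using step_f[OF funpow_in[OF assms]] by auto
  next
    case (step i)
    then show ?case
      using step_f[OF funpow_in[OF assms], of n i] by (auto intro: tranclp_into_tranclp2)
  qed
  have "finite ((\<lambda>i. p n ((f ^^ i) z)) ` UNIV)"
    using funpow_in[OF assms] by (intro finite_subset[OF _ finite_labels[of n]]) auto
  then obtain N where N: "infinite {i. p n ((f ^^ i) z) = p n ((f ^^ N) z)}"
    using pigeonhole_infinite[OF infinite_UNIV_nat] by fastforce
  have "(f ^^ j) z \<in> cls n ((f ^^ N) z)" if "j \<ge> N" for j
  proof -
    have return: "reach n ((f ^^ j) z) ((f ^^ N) z)" for j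
    proof -
      obtain i where "i > j" "p n ((f ^^ i) z) = p n ((f ^^ N) z)"
        using N unfolding infinite_nat_iff_unbounded by blast
      then show ?thesis
        using orbit reach_target funpow_in[OF assms] by metis
    qed
    then show ?thesis
      using orbit[of N j] that by (cases "j = N") (auto simp: cls_def)
  qed
  then show ?thesis
    by blast
qed

text \<open>Only finitely many classes have to be beaten, so it suffices to shadow a periodic walk through
  one witness word for each of them.\<close>

lemma refine_class:
  assumes x: "x \<in> cls (Suc n) x"
  shows "\<exists>z. z \<in> cls (Suc (Suc n)) z \<and> z \<in> cls n x \<and>
           lang n (Suc n) (cls (Suc n) x) \<subseteq> lang n (Suc (Suc n)) (cls (Suc (Suc n)) z)"
proof (rule ccontr)
  assume contra: "\<not> ?thesis"
  let ?K = "cls (Suc n) x" and ?m = "Suc (Suc n)"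
  \<comment> \<open>\<open>Z\<close> collects the candidates for the conclusion. By contradiction
    each of their finitely many classes misses some word of \<open>?K\<close>, chosen below as
    \<open>w\<close>.\<close>
  define Z where "Z = {z. z \<in> cls ?m z \<and> z \<in> cls n x}"
  have "finite (cls ?m ` Z)"
    by (rule finite_subset[OF _ finite_cls[of ?m]]) (auto simp: Z_def dest: cls_in)
  have "\<forall>L\<in>cls ?m ` Z. \<exists>w. walk (Suc n) ?K w \<and> map (p n) w \<notin> lang n ?m L"
    using contra by (auto simp: Z_def lang_def)
  then obtain w where w: "\<And>L. L \<in> cls ?m ` Z \<Longrightarrow> walk (Suc n) ?K (w L) \<and> map (p n) (w L) \<notin> lang n ?m L"
    by metis
  have "finite (w ` cls ?m ` Z)" "\<forall>v\<in>w ` cls ?m ` Z. walk (Suc n) ?K v"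
    using \<open>finite (cls ?m ` Z)\<close> w by auto
  from closed_walk_through_finitely_many[OF this x]
  obtain us where us: "us \<noteq> []" "hd us = x" "walk (Suc n) ?K (us @ [x])"
    "\<forall>v\<in>w ` cls ?m ` Z. \<exists>as bs. us = as @ v @ bs"
    by blast
  define T where "T = length us"
  \<comment> \<open>The closed walk, repeated with period \<open>T\<close>.\<close>
  define ys where "ys i = us ! (i mod T)" for i
  have "T > 0"
    using us(1) by (simp add: T_def)
  have ys_K: "ys i \<in> ?K" for i
  proof -
    have "ys i \<in> set us"
      using \<open>T > 0\<close> by (simp add: ys_def T_def)
    then show ?thesis
      using us(3) by (auto simp: walk_def)
  qed
  have ys_step: "step (Suc n) (ys i) (ys (Suc i))" for i
  proof -
    define j where "j = i mod T"
    have "j < T"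
      using \<open>T > 0\<close> by (simp add: j_def)
    then have "step (Suc n) ((us @ [x]) ! j) ((us @ [x]) ! Suc j)"
      using us(3) by (auto simp: walk_def successively_iff_nth T_def)
    moreover have "(us @ [x]) ! j = ys i"
      using \<open>j < T\<close> by (simp add: nth_append T_def ys_def j_def)
    moreover have "(us @ [x]) ! Suc j = ys (Suc i)"
    proof (cases "Suc j = T")
      case True
      then have "Suc i mod T = 0"
        by (simp add: j_def mod_Suc)
      then show ?thesis
        using True us(1,2) by (simp add: nth_append T_def ys_def hd_conv_nth)
    next
      case False
      then have "Suc i mod T = Suc j" "Suc j < T"
        using \<open>j < T\<close> by (auto simp: j_def mod_Suc)
      then show ?thesis
        by (simp add: nth_append T_def ys_def)
    qed
    ultimately show ?thesis
      by simp
  qed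
  obtain z where z: "z \<in> S" "\<And>i. p n ((f ^^ i) z) = p n (ys i)"
    using shadow[of ys n] ys_step unfolding step_def by blast
  have orbit: "(f ^^ i) z \<in> S" for i
    using z(1) by (rule funpow_in)
  obtain N where N: "\<And>j. j \<ge> N \<Longrightarrow> (f ^^ j) z \<in> cls ?m ((f ^^ N) z)"
    using orbit_eventually_in_class[OF z(1)] by blast
  define u where "u = (f ^^ N) z"
  have "u \<in> cls ?m u"
    using N[of N] by (simp add: u_def)
  moreover have "u \<in> cls n x"
  proof -
    have yN: "reach n x (ys N)" "reach n (ys (Suc N)) x"
      using ys_K cls_antimono[of n "Suc n" x] by (auto simp: cls_def)
    have "reach n x u"
      using yN(1) z(2)[of N] orbit by (auto simp: u_def intro: reach_target)
    \<comment> \<open>The label of \<open>u\<close> alone does not control where \<open>u\<close>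
      can go; the label of \<open>f u\<close> does, and it agrees with that of the next entry of
      \<open>ys\<close>.\<close>
    moreover have "step n u (ys (Suc N))"
      using z(2)[of "Suc N"] orbit ys_step[of N] by (auto simp: u_def step_def)
    ultimately show ?thesis
      using yN(2) by (auto simp: cls_def intro: tranclp_into_tranclp2)
  qed
  ultimately have "cls ?m u \<in> cls ?m ` Z"
    by (auto simp: Z_def)
  define v where "v = w (cls ?m u)"
  have v: "map (p n) v \<notin> lang n ?m (cls ?m u)"
    using w \<open>cls ?m u \<in> cls ?m ` Z\<close> by (simp add: v_def)
  obtain as bs where "us = as @ v @ bs"
    using us(4) \<open>cls ?m u \<in> cls ?m ` Z\<close> unfolding v_def by blast
  \<comment> \<open>The multiple \<open>N * T\<close> of the period is at least \<open>N\<close>, so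
    from time \<open>a\<close> on the orbit reads the word \<open>v\<close> while it already stays
    in the class of \<open>u\<close>.\<close>
  define a where "a = N * T + length as"
  define vs where "vs = map (\<lambda>i. (f ^^ (a + i)) z) [0..<length v]"
  have "a \<ge> N"
    using \<open>T > 0\<close> by (simp add: a_def trans_le_add1)
  have "walk ?m (cls ?m u) vs"
  proof -
    have "set vs \<subseteq> cls ?m u"
      using N \<open>a \<ge> N\<close> by (auto simp: vs_def u_def)
    moreover have "successively (step ?m) vs"
      using step_f[OF orbit] by (auto simp: successively_iff_nth vs_def)
    ultimately show ?thesis
      by (simp add: walk_def)
  qed
  moreover have "map (p n) vs = map (p n) v"
  proof (rule nth_equalityI)
    fix i assume "i < length (map (p n) vs)"
    then have i: "i < length v"
      by (simp add: vs_def)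
    then have "length as + i < T"
      using \<open>us = as @ v @ bs\<close> by (simp add: T_def)
    then have "ys (a + i) = v ! i"
      using \<open>us = as @ v @ bs\<close> i by (simp add: ys_def a_def add.assoc nth_append)
    then show "map (p n) vs ! i = map (p n) v ! i"
      using i z(2)[of "a + i"] by (simp add: vs_def)
  qed (simp add: vs_def)
  ultimately have "map (p n) v \<in> lang n ?m (cls ?m u)"
    unfolding lang_def by (metis (mono_tags) image_eqI mem_Collect_eq)
  with v show False
    by blast
qed

section \<open>Classes whose words survive at later levels\<close>

text \<open>By monotonicity the inclusion is an equality: no word of level \<open>k\<close> is lost
  when the class of \<open>z\<close> shrinks by one level.\<close>

definition stable :: "nat \<Rightarrow> 'a \<Rightarrow> bool" where
  "stable k z \<longleftrightarrow> z \<in> cls (Suc (Suc k)) z \<and>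
     lang k (Suc k) (cls (Suc k) z) \<subseteq> lang k (Suc (Suc k)) (cls (Suc (Suc k)) z)"

text \<open>Maximality of the language among the finitely many classes inside \<open>cls k c\<close> turns the inclusion of
  \<open>refine_class\<close> into an equality.\<close>

lemma exists_stable:
  assumes c: "c \<in> cls (Suc k) c"
  shows "\<exists>z. stable k z \<and> z \<in> cls k c \<and>
           lang k (Suc k) (cls (Suc k) c) \<subseteq> lang k (Suc k) (cls (Suc k) z)"
proof -
  define Y where "Y = {y. y \<in> cls (Suc k) y \<and> y \<in> cls k c}"
  define \<Lambda> where "\<Lambda> y = lang k (Suc k) (cls (Suc k) y)" for y
  have "\<Lambda> ` Y \<subseteq> lang k (Suc k) ` cls (Suc k) ` S"
    by (auto simp: Y_def \<Lambda>_def dest: cls_in)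
  then have "finite (\<Lambda> ` Y)"
    using finite_cls finite_subset by blast
  moreover have "c \<in> Y"
    using c cls_antimono[of k "Suc k" c] by (auto simp: Y_def)
  ultimately obtain y where y: "y \<in> Y" "\<Lambda> c \<subseteq> \<Lambda> y"
    and max: "\<And>b. b \<in> Y \<Longrightarrow> \<Lambda> y \<subseteq> \<Lambda> b \<Longrightarrow> \<Lambda> y = \<Lambda> b"
    using finite_has_maximal2[of "\<Lambda> ` Y" "\<Lambda> c"] by auto
  obtain z where z: "z \<in> cls (Suc (Suc k)) z" "z \<in> cls k y"
    "\<Lambda> y \<subseteq> lang k (Suc (Suc k)) (cls (Suc (Suc k)) z)"
    using refine_class[of y k] y(1) by (auto simp: Y_def \<Lambda>_def)
  \<comment> \<open>Together with the choice of \<open>z\<close> this gives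
    \<open>\<Lambda> y \<subseteq> \<Lambda> z\<close>, and maximality of \<open>\<Lambda> y\<close>
    closes the circle.\<close>
  have "lang k (Suc (Suc k)) (cls (Suc (Suc k)) z) \<subseteq> \<Lambda> z"
    unfolding \<Lambda>_def by (intro lang_mono cls_antimono) auto
  moreover have "z \<in> Y"
    using z y(1) cls_eq[of y k c] cls_antimono[of "Suc k" "Suc (Suc k)" z] by (auto simp: Y_def)
  ultimately have "\<Lambda> y = \<Lambda> z"
    using max z(3) by blast
  then have "stable k z"
    using z by (simp add: stable_def \<Lambda>_def)
  moreover have "z \<in> cls k c"
    using \<open>z \<in> Y\<close> by (simp add: Y_def)
  ultimately show ?thesis
    using y(2) \<open>\<Lambda> y = \<Lambda> z\<close> unfolding \<Lambda>_def by blast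
qed

text \<open>Stability of \<open>h i\<close> carries its words to the next class of
  \<open>h i\<close>; \<open>exists_stable\<close>, applied one level higher, carries them on to the
  class of \<open>h (Suc i)\<close>. That second inclusion concerns finer labels and is coarsened
  first.\<close>

lemma stable_sequence:
  assumes c: "c \<in> cls (Suc k) c"
  shows "\<exists>h. h 0 \<in> cls k c \<and> (\<forall>i. stable (k + i) (h i) \<and> h (Suc i) \<in> cls (Suc (k + i)) (h i) \<and>
           lang (k + i) (Suc (k + i)) (cls (Suc (k + i)) (h i)) \<subseteq>
           lang (k + i) (Suc (Suc (k + i))) (cls (Suc (Suc (k + i))) (h (Suc i))))"
proof -
  define Q where "Q i x y \<longleftrightarrow> y \<in> cls (Suc (k + i)) x \<and>
    lang (k + i) (Suc (k + i)) (cls (Suc (k + i)) x) \<subseteq>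
    lang (k + i) (Suc (Suc (k + i))) (cls (Suc (Suc (k + i))) y)" for i x y
  \<comment> \<open>The clause for \<open>i = 0\<close> carries the condition on \<open>h 0\<close>
    through the dependent choice.\<close>
  define P where "P i x \<longleftrightarrow> stable (k + i) x \<and> (i = 0 \<longrightarrow> x \<in> cls k c)" for i x
  have "\<exists>x. P 0 x"
    using exists_stable[OF c] by (auto simp: P_def)
  moreover have "\<exists>y. P (Suc i) y \<and> Q i x y" if "P i x" for i x
  proof -
    have x: "x \<in> cls (Suc (Suc (k + i))) x"
      "lang (k + i) (Suc (k + i)) (cls (Suc (k + i)) x) \<subseteq>
       lang (k + i) (Suc (Suc (k + i))) (cls (Suc (Suc (k + i))) x)"
      using that by (auto simp: P_def stable_def)
    obtain y where y: "stable (Suc (k + i)) y" "y \<in> cls (Suc (k + i)) x"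
      "lang (Suc (k + i)) (Suc (Suc (k + i))) (cls (Suc (Suc (k + i))) x) \<subseteq>
       lang (Suc (k + i)) (Suc (Suc (k + i))) (cls (Suc (Suc (k + i))) y)"
      using exists_stable[OF x(1)] by blast
    have "lang (k + i) (Suc (Suc (k + i))) (cls (Suc (Suc (k + i))) x) \<subseteq>
          lang (k + i) (Suc (Suc (k + i))) (cls (Suc (Suc (k + i))) y)"
      by (rule lang_coarsen[OF y(3)]) (auto dest: cls_in)
    then show ?thesis
      using x(2) y(1,2) by (intro exI[of _ y]) (auto simp: P_def Q_def)
  qed
  ultimately obtain h where "\<forall>i. P i (h i) \<and> Q i (h i) (h (Suc i))"
    using dependent_nat_choice[of P Q] by blast
  then show ?thesis
    by (intro exI[of _ h]) (auto simp: P_def Q_def)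
qed

section \<open>Compactness of sets determined by labels\<close>

lemma continuous_funpow: "continuous_on S (f ^^ i)"
proof (induction i)
  case (Suc i)
  have "continuous_on ((f ^^ i) ` S) f"
    using continuous_on_subset[OF continuous] funpow_in by blast
  then show ?case
    using continuous_on_compose[OF Suc.IH] by simp
qed (simp add: continuous_on_id id_def)

lemma eventually_same_label:
  assumes "x \<in> S"
  shows "eventually (\<lambda>y. p n ((f ^^ i) y) = p n ((f ^^ i) x)) (at x within S)"
proof -
  obtain \<delta> where \<delta>: "\<delta> > 0" "\<And>x y. x \<in> S \<Longrightarrow> y \<in> S \<Longrightarrow> dist x y \<le> \<delta> \<Longrightarrow> p n x = p n y"
    using locally_constant by blast
  have "((f ^^ i) \<longlongrightarrow> (f ^^ i) x) (at x within S)"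
    using continuous_funpow assms by (auto simp: continuous_on_def)
  then have "eventually (\<lambda>y. dist ((f ^^ i) y) ((f ^^ i) x) < \<delta>) (at x within S)"
    using \<delta>(1) by (rule tendstoD)
  moreover have "eventually (\<lambda>y. y \<in> S) (at x within S)"
    by (simp add: eventually_at_filter)
  ultimately show ?thesis
    by eventually_elim (use \<delta>(2) assms funpow_in in auto)
qed

text \<open>The labels of finitely many iterates are locally constant on \<open>S\<close>, so a
  limit point of \<open>T\<close> shares them with a nearby point of \<open>T\<close>.\<close>

lemma closed_if_determined_by_labels:
  assumes "T \<subseteq> S"
    and labels: "\<And>x y. \<lbrakk>x \<in> S; y \<in> T; \<forall>i\<le>m. p n ((f ^^ i) x) = p n ((f ^^ i) y)\<rbrakk> \<Longrightarrow> x \<in> T"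
  shows "closed T"
proof -
  have "x \<in> T" if "x islimpt T" for x
  proof -
    have "closed S"
      using compact by (rule compact_imp_closed)
    then have "x \<in> S"
      using that assms(1) by (meson closed_limpt islimpt_subset)
    then have "eventually (\<lambda>y. \<forall>i\<in>{..m}. p n ((f ^^ i) y) = p n ((f ^^ i) x)) (at x within S)"
      by (intro eventually_ball_finite ballI eventually_same_label) auto
    then obtain e where "e > 0"
      and e: "\<And>y. \<lbrakk>y \<in> S; y \<noteq> x; dist y x < e\<rbrakk> \<Longrightarrow> \<forall>i\<le>m. p n ((f ^^ i) y) = p n ((f ^^ i) x)"
      unfolding eventually_at by auto
    then obtain y where "y \<in> T" "y \<noteq> x" "dist y x < e"
      using \<open>x islimpt T\<close> unfolding islimpt_approachable by blast
    then show ?thesis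
      using e labels[OF \<open>x \<in> S\<close>] assms(1) by (metis subsetD)
  qed
  then show ?thesis
    by (simp add: closed_limpt)
qed

lemma compact_if_closed: "T \<subseteq> S \<Longrightarrow> closed T \<Longrightarrow> compact T"
  using compact_Int_closed[OF compact] by (metis inf.absorb2)

lemma compact_cls: "compact (cls n x)"
proof (rule compact_if_closed)
  show "closed (cls n x)"
  proof (rule closed_if_determined_by_labels[of _ 1 n])
    fix y z assume "y \<in> S" "z \<in> cls n x" "\<forall>i\<le>1. p n ((f ^^ i) y) = p n ((f ^^ i) z)"
    moreover from this(3)[rule_format, of 0] this(3)[rule_format, of 1]
    have "p n y = p n z" "p n (f y) = p n (f z)"
      by simp_all
    ultimately show "y \<in> cls n x"
      using cls_cong by blast
  qed (auto dest: cls_in)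
qed (auto dest: cls_in)

section \<open>Shadowing inside a chain component\<close>

text \<open>The walk is prolonged by the true orbit of its last point, which makes
  \<open>shadow\<close> applicable. A second letter is required to lead the shadowing point back
  into the class.\<close>

lemma shadow_walk:
  assumes ys: "walk (Suc m) (cls (Suc m) h) ys" and len: "length ys \<ge> 2"
  shows "\<exists>y\<in>cls m h. \<forall>i<length ys. p m ((f ^^ i) y) = p m (ys ! i)"
proof -
  define r where "r = length ys - 1"
  have r: "r \<ge> 1" "length ys = Suc r"
    using len by (auto simp: r_def)
  define zs where "zs i = (if i < r then ys ! i else (f ^^ (i - r)) (ys ! r))" for i
  have zs_ys: "zs i = ys ! i" if "i < length ys" for i
    using that r by (cases "i = r") (auto simp: zs_def)
  have ys_cls: "ys ! i \<in> cls (Suc m) h" if "i < length ys" for i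
    using ys that by (auto simp: walk_def)
  have "step (Suc m) (zs i) (zs (Suc i))" for i
  proof (cases "i < r")
    case True
    then show ?thesis
      using ys r zs_ys by (auto simp: walk_def successively_iff_nth)
  next
    case False
    then have "zs (Suc i) = f (zs i)"
      by (simp add: zs_def Suc_diff_le)
    moreover have "zs i \<in> S"
      using False ys_cls[of r] r funpow_in cls_in by (auto simp: zs_def)
    ultimately show ?thesis
      using step_f by simp
  qed
  then obtain y where y: "y \<in> S" "\<And>i. p m ((f ^^ i) y) = p m (zs i)"
    using shadow[of zs m] unfolding step_def by blast
  have label: "p m ((f ^^ i) y) = p m (ys ! i)" if "i < length ys" for i
    using y(2)[of i] zs_ys that by simp
  have ys_cls': "ys ! i \<in> cls m h" if "i < length ys" for i
    using ys_cls[OF that] cls_antimono[of m "Suc m" h] by auto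
  have "reach m h y"
    using ys_cls'[of 0] label[of 0] y(1) r by (auto simp: cls_def intro: reach_target)
  moreover have "step m y (ys ! 1)"
    using label[of 1] y(1) r ys_cls'[of 1] by (auto simp: step_def dest: cls_in)
  then have "reach m y h"
    using ys_cls'[of 1] r by (auto simp: cls_def intro: tranclp_into_tranclp2)
  ultimately show ?thesis
    using label by (auto simp: cls_def)
qed

text \<open>Take \<open>d\<close> common to the nested classes of a \<open>stable_sequence\<close>.
  A fine pseudo-orbit in its component is followed for finite times by orbits starting in the
  classes of \<open>d\<close> of all later levels; compactness yields a starting point in the
  component. Membership in \<open>cls k c\<close> keeps the component near that of
  \<open>c\<close>.\<close>

lemma shadowing_component_nearby:
  assumes c: "\<And>n. c \<in> cls n c"
  shows "\<exists>d. (\<forall>n. d \<in> cls n d) \<and> d \<in> cls k c \<and> shadowing (\<Inter>n. cls n d) f"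
proof -
  obtain h where h0: "h 0 \<in> cls k c"
    and stable: "\<And>i. stable (k + i) (h i)"
    and h_Suc: "\<And>i. h (Suc i) \<in> cls (Suc (k + i)) (h i)"
    and lang_h: "\<And>i. lang (k + i) (Suc (k + i)) (cls (Suc (k + i)) (h i)) \<subseteq>
           lang (k + i) (Suc (Suc (k + i))) (cls (Suc (Suc (k + i))) (h (Suc i)))"
    using stable_sequence[OF c, of k] by blast
  define H where "H i = cls (Suc (k + i)) (h i)" for i
  have "H (Suc i) \<subseteq> H i" for i
    using cls_antimono[of "Suc (k + i)" "Suc (Suc (k + i))" "h (Suc i)"] cls_eq[OF h_Suc]
    by (simp add: H_def)
  moreover have "h i \<in> H i" for i
    using stable[of i] cls_antimono[of "Suc (k + i)" "Suc (Suc (k + i))" "h i"]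
    by (auto simp: H_def stable_def)
  moreover have "compact (H i)" for i
    by (simp add: H_def compact_cls)
  ultimately have "\<Inter>(range H) \<noteq> {}"
    by (intro nested_compact_Inter_nonempty) blast+
  then obtain d where d_H: "\<And>i. d \<in> H i"
    by blast
  have H_eq: "H i = cls (Suc (k + i)) d" for i
    using cls_eq[of d "Suc (k + i)" "h i"] d_H by (simp add: H_def)
  have d: "d \<in> cls n d" for n
    using d_H[of n] cls_antimono[of n "Suc (k + n)" d] by (auto simp: H_eq)
  have "d \<in> cls k c"
    using d_H[of 0] cls_antimono[of k "Suc k" "h 0"] cls_eq[OF h0] by (auto simp: H_def)
  have lang_H: "lang (k + i) (Suc (k + i)) (H i) \<subseteq> lang (k + i) (Suc (k + j)) (H j)" if "i \<le> j" for i j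
    using that
  proof (induction rule: dec_induct)
    case (step j)
    have "lang (k + i) (Suc (k + j)) (H j) \<subseteq> lang (k + i) (Suc (k + Suc j)) (H (Suc j))"
      by (rule lang_coarsen[of "k + j"]) (use lang_h[of j] step cls_subset in \<open>simp_all add: H_def\<close>)
    with step.IH show ?case
      by blast
  qed simp
  let ?D = "\<Inter>n. cls n d"
  have "shadowing ?D f"
    unfolding shadowing_def
  proof (intro allI impI)
    fix \<epsilon> :: real assume "\<epsilon> > 0"
    then obtain n where n: "\<And>x y. x \<in> S \<Longrightarrow> y \<in> S \<Longrightarrow> p n x = p n y \<Longrightarrow> dist x y \<le> \<epsilon>"
      using mesh by blast
    \<comment> \<open>The words of \<open>H n\<close> read at level \<open>k + n\<close> are those
      that \<open>lang_H\<close> preserves; labels at this level refine those at level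
      \<open>n\<close>.\<close>
    define N where "N = k + n"
    obtain \<delta> where \<delta>: "\<delta> > 0" "\<And>x y. x \<in> S \<Longrightarrow> y \<in> S \<Longrightarrow> dist x y \<le> \<delta> \<Longrightarrow> p (Suc N) x = p (Suc N) y"
      using locally_constant by blast
    have "\<exists>y\<in>?D. \<forall>i. dist ((f ^^ i) y) (xs i) \<le> \<epsilon>"
      if xs: "\<And>i. xs i \<in> ?D" "\<And>i. dist (f (xs i)) (xs (Suc i)) \<le> \<delta>" for xs
    proof -
      have xs_S: "xs i \<in> S" for i
        using xs(1)[of i] cls_subset[of 0 d] by blast
      have xs_step: "step (Suc N) (xs i) (xs (Suc i))" for i
        using \<delta>(2)[OF f_in[OF xs_S] xs_S xs(2)] xs_S by (simp add: step_def)
      \<comment> \<open>Starting points that follow \<open>xs\<close> up to time \<open>j\<close>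
        and lie in the class of \<open>d\<close> of level \<open>k + j\<close>.\<close>
      define G where "G j = {y \<in> cls (k + j) d. \<forall>i\<le>j. p N ((f ^^ i) y) = p N (xs i)}" for j
      have "G j \<noteq> {}" if "n \<le> j" for j
      proof -
        \<comment> \<open>One letter more than needed: \<open>shadow_walk\<close> asks for at least
          two, even if \<open>j = 0\<close>.\<close>
        define w where "w = map xs [0..<Suc (Suc j)]"
        have "walk (Suc N) (H n) w"
          using xs(1) xs_step
          by (auto simp: walk_def w_def successively_iff_nth H_eq N_def simp del: upt_Suc)
        then have "map (p N) w \<in> lang N (Suc N) (H n)"
          by (simp add: lang_def)
        \<comment> \<open>The word survives in \<open>H j\<close>, realised by other points
          \<open>ys\<close> with much finer steps. Shadowing \<open>ys\<close> at level
          \<open>k + j\<close> then follows \<open>xs\<close> at level \<open>N\<close>.\<close>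
        then have "map (p N) w \<in> lang N (Suc (k + j)) (H j)"
          using lang_H[OF that] by (auto simp: N_def)
        then obtain ys where ys: "walk (Suc (k + j)) (H j) ys" "map (p N) w = map (p N) ys"
          by (auto simp: lang_def)
        have len: "length ys = Suc (Suc j)"
          using ys(2) by (metis length_map w_def length_upt diff_zero)
        obtain y where y: "y \<in> cls (k + j) d" "\<And>i. i < length ys \<Longrightarrow> p (k + j) ((f ^^ i) y) = p (k + j) (ys ! i)"
          using shadow_walk[of "k + j" d ys] ys(1) len by (auto simp: H_eq)
        have "p N ((f ^^ i) y) = p N (xs i)" if "i \<le> j" for i
        proof -
          have "ys ! i \<in> H j"
            using ys(1) len that by (auto simp: walk_def)
          then have "ys ! i \<in> S"
            unfolding H_def using cls_subset by blast
          then have "p N ((f ^^ i) y) = p N (ys ! i)"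
          proof (intro refine_le[of N "k + j"])
            show "N \<le> k + j"
              using \<open>n \<le> j\<close> by (simp add: N_def)
            show "(f ^^ i) y \<in> S"
              using y(1) cls_subset by (blast intro: funpow_in)
            show "p (k + j) ((f ^^ i) y) = p (k + j) (ys ! i)"
              using y(2) that len by simp
          qed
          also have "\<dots> = map (p N) w ! i"
            using ys(2) len that by (simp add: nth_map)
          also have "\<dots> = p N (xs i)"
            using that by (simp add: w_def nth_map del: upt_Suc)
          finally show ?thesis .
        qed
        then show ?thesis
          using y(1) by (auto simp: G_def)
      qed
      moreover have "compact (G j)" if "n \<le> j" for j
      proof (rule compact_if_closed)
        show "G j \<subseteq> S"
          using cls_subset by (auto simp: G_def)
        show "closed (G j)"
        \<comment> \<open>The bound \<open>Suc j\<close> keeps the label of \<open>f x\<close>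
          available for \<open>j = 0\<close>; membership in the class depends on it.\<close>
        proof (rule closed_if_determined_by_labels[of _ "Suc j" "k + j"])
          fix x y assume x: "x \<in> S" and y: "y \<in> G j"
            and eq: "\<forall>i\<le>Suc j. p (k + j) ((f ^^ i) x) = p (k + j) ((f ^^ i) y)"
          have "p (k + j) x = p (k + j) y" "p (k + j) (f x) = p (k + j) (f y)"
            using eq[rule_format, of 0] eq[rule_format, of 1] by simp_all
          then have "x \<in> cls (k + j) d"
            using x y cls_cong by (auto simp: G_def)
          moreover have "p N ((f ^^ i) x) = p N ((f ^^ i) y)" if "i \<le> j" for i
          proof (rule refine_le)
            show "N \<le> k + j"
              using \<open>n \<le> j\<close> by (simp add: N_def)
            show "(f ^^ i) x \<in> S" "(f ^^ i) y \<in> S"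
              using x y \<open>G j \<subseteq> S\<close> by (auto intro: funpow_in)
            show "p (k + j) ((f ^^ i) x) = p (k + j) ((f ^^ i) y)"
              using eq that by simp
          qed
          ultimately show "x \<in> G j"
            using y by (auto simp: G_def)
        qed fact
      qed
      moreover have "G (Suc j) \<subseteq> G j" for j
        using cls_antimono[of "k + j" "k + Suc j" d] by (auto simp: G_def)
      \<comment> \<open>The sequence starts at index \<open>n\<close>, from which on
        \<open>G\<close> is known to be nonempty.\<close>
      ultimately have "\<Inter>(range (\<lambda>i. G (n + i))) \<noteq> {}"
        by (intro nested_compact_Inter_nonempty) simp_all
      then obtain y where y: "\<And>i. y \<in> G (n + i)"
        by blast
      have "y \<in> cls m d" for m
        using y[of m] cls_antimono[of m "k + (n + m)" d] by (auto simp: G_def)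
      moreover have "dist ((f ^^ i) y) (xs i) \<le> \<epsilon>" for i
      proof (rule n)
        have "y \<in> S"
          using \<open>y \<in> cls 0 d\<close> cls_subset by blast
        then show "(f ^^ i) y \<in> S" "xs i \<in> S"
          using xs_S funpow_in by auto
        moreover have "p N ((f ^^ i) y) = p N (xs i)"
          using y[of i] by (simp add: G_def)
        ultimately show "p n ((f ^^ i) y) = p n (xs i)"
          by (intro refine_le[of n N]) (simp_all add: N_def)
      qed
      ultimately show ?thesis
        by (intro bexI[of _ y]) auto
    qed
    then show "\<exists>\<delta>>0. \<forall>xs. (\<forall>i. xs i \<in> ?D) \<and> (\<forall>i. dist (f (xs i)) (xs (Suc i)) \<le> \<delta>) \<longrightarrow>
        (\<exists>y\<in>?D. \<forall>i. dist ((f ^^ i) y) (xs i) \<le> \<epsilon>)"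
      using \<delta>(1) by blast
  qed
  with d \<open>d \<in> cls k c\<close> show ?thesis
    by blast
qed

section \<open>Chain components and their quotient topology\<close>

text \<open>Local constancy turns fine chains into steps of level \<open>n\<close>; conversely, a
  small mesh turns steps into chains.\<close>

lemma chain_to_iff_reach:
  "(\<forall>\<delta>>0. chain_to S f \<delta> x y) \<longleftrightarrow> (\<forall>n. reach n x y)"
proof (intro iffI allI impI)
  fix n assume chains: "\<forall>\<delta>>0. chain_to S f \<delta> x y"
  obtain \<delta> where \<delta>: "\<delta> > 0" "\<And>x y. x \<in> S \<Longrightarrow> y \<in> S \<Longrightarrow> dist x y \<le> \<delta> \<Longrightarrow> p n x = p n y"
    using locally_constant by blast
  then obtain k xs where k: "k > 0" and xs: "\<And>i. i \<le> k \<Longrightarrow> xs i \<in> S" "xs 0 = x" "xs k = y"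
    "\<And>i. i < k \<Longrightarrow> dist (f (xs i)) (xs (Suc i)) \<le> \<delta>"
    using chains unfolding chain_to_def by blast
  have "step n (xs i) (xs (Suc i))" if "i < k" for i
    using that xs(1)[of i] xs(1)[of "Suc i"] xs(4)[of i] \<delta>(2)[OF f_in] by (auto simp: step_def)
  note steps = this
  have "reach n (xs 0) (xs j)" if "0 < j" "j \<le> k" for j
    using that
  proof (induction j rule: nat_induct_non_zero)
    case 1
    then show ?case
      using steps[of 0] by auto
  next
    case (Suc j)
    then show ?case
      using steps[of j] by (auto intro: tranclp.trancl_into_trancl)
  qed
  then show "reach n x y"
    using k xs by auto
next
  fix \<delta> :: real assume reach: "\<forall>n. reach n x y" and "\<delta> > 0"
  then obtain n where n: "\<And>x y. x \<in> S \<Longrightarrow> y \<in> S \<Longrightarrow> p n x = p n y \<Longrightarrow> dist x y \<le> \<delta>"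
    using mesh by blast
  have step_dist: "dist (f x) y \<le> \<delta>" if "step n x y" for x y
    using that n f_in by (auto simp: step_def)
  have "reach n x y"
    using reach by blast
  then show "chain_to S f \<delta> x y"
  proof (induction rule: tranclp_induct)
    case (base y)
    then show ?case
      unfolding chain_to_def using step_dist[OF base]
      by (intro exI[of _ 1] exI[of _ "\<lambda>i. if i = 0 then x else y"]) (auto simp: step_def)
  next
    case (step y z)
    then obtain k xs where "k > 0" "\<And>i. i \<le> k \<Longrightarrow> xs i \<in> S" "xs 0 = x" "xs k = y"
      "\<And>i. i < k \<Longrightarrow> dist (f (xs i)) (xs (Suc i)) \<le> \<delta>"
      unfolding chain_to_def by blast
    moreover have "z \<in> S"
      using step(2) by (simp add: step_def)
    ultimately show ?case
      unfolding chain_to_def using step_dist[OF step(2)]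
      by (intro exI[of _ "Suc k"] exI[of _ "xs(Suc k := z)"]) (auto simp: less_Suc_eq le_Suc_eq)
  qed
qed

lemma chain_recurrent_eq: "chain_recurrent S f = {x. \<forall>n. x \<in> cls n x}"
  unfolding chain_recurrent_def chain_to_iff_reach cls_def using reach_in by auto

lemma chain_equiv_eq: "chain_equiv S f = {(x, y). \<forall>n. y \<in> cls n x}"
proof -
  have "(\<forall>\<delta>>0. chain_to S f \<delta> x y \<and> chain_to S f \<delta> y x) \<longleftrightarrow> (\<forall>n. y \<in> cls n x)" for x y
    using chain_to_iff_reach[of x y] chain_to_iff_reach[of y x] by (auto simp: cls_def)
  then show ?thesis
    unfolding chain_equiv_def chain_recurrent_eq using cls_self cls_sym by blast
qed

lemma equiv_chain_equiv: "equiv (chain_recurrent S f) (chain_equiv S f)"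
proof (rule equivI)
  show "trans (chain_equiv S f)"
    unfolding chain_equiv_eq by (rule transI) (use cls_eq in blast)
  show "sym (chain_equiv S f)"
    unfolding chain_equiv_eq by (rule symI) (use cls_sym in blast)
  show "chain_equiv S f \<subseteq> chain_recurrent S f \<times> chain_recurrent S f"
    by (auto simp: chain_equiv_def)
  show "refl_on (chain_recurrent S f) (chain_equiv S f)"
    by (auto simp: refl_on_def chain_equiv_eq chain_recurrent_eq)
qed

lemma chain_component_eq: "chain_equiv S f `` {x} = (\<Inter>n. cls n x)"
  by (auto simp: chain_equiv_eq)

text \<open>The unfolding of \<open>topology\<close> requires the topology axioms. Closure under
  intersection rests on the disjointness of distinct components.\<close>

lemma openin_chain_components_topology:
  "openin (chain_components_topology S f) U \<longleftrightarrow>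
     U \<subseteq> chain_components S f \<and> openin (top_of_set (chain_recurrent S f)) (\<Union>U)"
proof -
  have "\<Union>(U \<inter> V) = \<Union>U \<inter> \<Union>V"
    if "U \<subseteq> chain_components S f" "V \<subseteq> chain_components S f" for U V
    using that quotient_disj[OF equiv_chain_equiv] unfolding chain_components_def by blast
  moreover have "\<Union>(\<Union>\<K>) = \<Union>(Union ` \<K>)" for \<K> :: "'a set set set"
    by blast
  moreover have "openin (top_of_set (chain_recurrent S f)) (\<Union>(Union ` \<K>))"
    if "\<forall>U\<in>\<K>. openin (top_of_set (chain_recurrent S f)) (\<Union>U)" for \<K> :: "'a set set set"
    using that by (intro openin_Union) blast
  ultimately have "istopology (\<lambda>U. U \<subseteq> chain_components S f \<and>
      openin (top_of_set (chain_recurrent S f)) (\<Union>U))"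
    unfolding istopology_def by (simp add: openin_Int Union_least le_infI1)
  then show ?thesis
    unfolding chain_components_topology_def by simp
qed

lemma topspace_chain_components_topology:
  "topspace (chain_components_topology S f) = chain_components S f"
proof -
  have "openin (chain_components_topology S f) (chain_components S f)"
    unfolding openin_chain_components_topology chain_components_def
    by (simp add: Union_quotient[OF equiv_chain_equiv])
  moreover have "topspace (chain_components_topology S f) \<subseteq> chain_components S f"
    using openin_topspace[of "chain_components_topology S f"]
    unfolding openin_chain_components_topology by (rule conjunct1)
  ultimately show ?thesis
    using openin_subset by (intro subset_antisym)
qed

lemma compact_chain_recurrent: "compact (chain_recurrent S f)"
proof (rule compact_if_closed)
  show "chain_recurrent S f \<subseteq> S"
    by (auto simp: chain_recurrent_def)
  have closed: "closed {x. x \<in> cls n x}" for n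
  proof (rule closed_if_determined_by_labels[of _ 1 n])
    fix y z assume y: "y \<in> S" and z: "z \<in> {x. x \<in> cls n x}"
      and eq: "\<forall>i\<le>1. p n ((f ^^ i) y) = p n ((f ^^ i) z)"
    have "y \<in> cls n z"
      using cls_cong[of z n z y] y z eq[rule_format, of 0] eq[rule_format, of 1] by simp
    then show "y \<in> {x. x \<in> cls n x}"
      by (auto dest: cls_self)
  qed (auto dest: cls_in)
  show "closed (chain_recurrent S f)"
    unfolding chain_recurrent_eq Collect_all_eq by (intro closed_INT ballI closed)
qed

text \<open>Otherwise the recurrent points outside \<open>\<Union>U\<close> meet every
  \<open>cls k c\<close>, and compactness gives one lying in all of them, hence in
  \<open>C\<close>.\<close>

lemma class_within_open:
  assumes U: "openin (chain_components_topology S f) U" and "C \<in> U" "c \<in> C"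
  shows "\<exists>k. \<forall>d\<in>chain_recurrent S f. d \<in> cls k c \<longrightarrow> d \<in> \<Union>U"
proof (rule ccontr)
  assume contra: "\<not> ?thesis"
  have "C \<in> chain_components S f"
    using U \<open>C \<in> U\<close> by (auto simp: openin_chain_components_topology)
  then obtain x where "C = (\<Inter>n. cls n x)"
    unfolding chain_components_def by (auto simp: chain_component_eq elim!: quotientE)
  then have C: "C = (\<Inter>n. cls n c)"
    using \<open>c \<in> C\<close> cls_eq[of c _ x] by simp
  define F where "F k = (chain_recurrent S f - \<Union>U) \<inter> cls k c" for k
  have "closedin (top_of_set (chain_recurrent S f)) (chain_recurrent S f - \<Union>U)"
    using U unfolding openin_chain_components_topology by (intro closedin_diff closedin_self) simp
  then have "compact (chain_recurrent S f - \<Union>U)"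
    by (rule closedin_compact[OF compact_chain_recurrent])
  then have "compact (F k)" for k
    unfolding F_def using compact_cls by (intro compact_Int)
  moreover have "F k \<noteq> {}" for k
    using contra unfolding F_def by blast
  moreover have "F (Suc k) \<subseteq> F k" for k
    using cls_antimono[of k "Suc k" c] by (auto simp: F_def)
  ultimately have "\<Inter>(range F) \<noteq> {}"
    by (rule nested_compact_Inter_nonempty)
  then obtain y where "\<And>k. y \<in> F k"
    by blast
  then have "y \<in> C" "y \<notin> \<Union>U"
    by (auto simp: C F_def)
  then show False
    using \<open>C \<in> U\<close> by blast
qed

theorem shadowing_components_dense:
  "chain_components_topology S f closure_of shadowing_components S f = chain_components S f"
proof
  show "chain_components_topology S f closure_of shadowing_components S f \<subseteq> chain_components S f"
    using closure_of_subset_topspace topspace_chain_components_topology by metis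
  show "chain_components S f \<subseteq> chain_components_topology S f closure_of shadowing_components S f"
  proof
    fix C assume C: "C \<in> chain_components S f"
    then obtain c where "c \<in> C" and c: "\<And>n. c \<in> cls n c"
      unfolding chain_components_def
      by (auto simp: chain_component_eq chain_recurrent_eq elim!: quotientE)
    have "\<exists>D\<in>shadowing_components S f. D \<in> U"
      if "C \<in> U" and U: "openin (chain_components_topology S f) U" for U
    proof -
      obtain k where k: "\<And>d. d \<in> chain_recurrent S f \<Longrightarrow> d \<in> cls k c \<Longrightarrow> d \<in> \<Union>U"
        using class_within_open[OF U \<open>C \<in> U\<close> \<open>c \<in> C\<close>] by blast
      obtain d where d: "\<And>n. d \<in> cls n d" "d \<in> cls k c" "shadowing (\<Inter>n. cls n d) f"
        using shadowing_component_nearby[of c k] c by blast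
      let ?D = "\<Inter>n. cls n d"
      have "d \<in> chain_recurrent S f"
        using d(1) by (simp add: chain_recurrent_eq)
      then have D: "?D \<in> chain_components S f"
        unfolding chain_components_def using quotientI[of d _ "chain_equiv S f"]
        by (simp add: chain_component_eq)
      \<comment> \<open>The component \<open>V\<close> in \<open>U\<close> containing
        \<open>d\<close> meets \<open>?D\<close> and therefore equals it.\<close>
      obtain V where "V \<in> U" "d \<in> V"
        using k[OF \<open>d \<in> chain_recurrent S f\<close> d(2)] by blast
      moreover have "V \<in> chain_components S f"
        using U \<open>V \<in> U\<close> by (auto simp: openin_chain_components_topology)
      then have "V = ?D \<or> V \<inter> ?D = {}"
        using D unfolding chain_components_def by (rule quotient_disj[OF equiv_chain_equiv])
      moreover have "d \<in> ?D"
        using d(1) by (rule INT_I)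
      ultimately have "?D \<in> U"
        by (metis disjoint_iff)
      moreover have "?D \<in> shadowing_components S f"
        using D d(3) by (simp add: shadowing_components_def)
      ultimately show ?thesis
        by blast
    qed
    then show "C \<in> chain_components_topology S f closure_of shadowing_components S f"
      using C unfolding in_closure_of topspace_chain_components_topology by blast
  qed
qed

end

section \<open>Labellings from zero-dimensionality and shadowing\<close>

text \<open>The indicator function of \<open>V\<close> is continuous on the compact set
  \<open>S\<close>, hence uniformly continuous, and its values differ by 0 or 1.\<close>

lemma clopen_locally_constant:
  fixes S :: "'a::metric_space set"
  assumes "compact S" "openin (top_of_set S) V" "closedin (top_of_set S) V"
  shows "\<exists>\<delta>>0. \<forall>x\<in>S. \<forall>y\<in>S. dist x y \<le> \<delta> \<longrightarrow> (x \<in> V \<longleftrightarrow> y \<in> V)"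
proof -
  define g :: "'a \<Rightarrow> real" where "g x = (if x \<in> V then 1 else 0)" for x
  have S_eq: "V \<union> (S - V) = S"
    using closedin_subset[OF assms(3)] by auto
  have "closedin (top_of_set S) (S - V)"
    by (rule closedin_diff[OF closedin_self assms(2)])
  then have "continuous_on (V \<union> (S - V)) g"
    unfolding g_def using assms(3)
    by (intro continuous_on_cases_local[of V "S - V"] continuous_on_const) (simp_all only: S_eq, blast)
  then have "uniformly_continuous_on S g"
    unfolding S_eq using assms(1) by (rule compact_uniformly_continuous)
  then obtain d where "d > 0" and d: "\<And>x y. x \<in> S \<Longrightarrow> y \<in> S \<Longrightarrow> dist y x < d \<Longrightarrow> dist (g y) (g x) < 1"
    unfolding uniformly_continuous_on_def by (elim allE[of _ 1]) auto
  have "x \<in> V \<longleftrightarrow> y \<in> V" if "x \<in> S" "y \<in> S" "dist x y \<le> d / 2" for x y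
  proof -
    have "dist x y < d"
      using that(3) \<open>d > 0\<close> by linarith
    then have "dist (g x) (g y) < 1"
      by (rule d[OF that(2,1)])
    then show ?thesis
      by (cases "x \<in> V"; cases "y \<in> V") (simp_all add: g_def)
  qed
  moreover have "d / 2 > 0"
    using \<open>d > 0\<close> by simp
  ultimately show ?thesis
    by blast
qed

lemma finite_clopen_locally_constant:
  fixes S :: "'a::metric_space set"
  assumes "compact S" "finite \<V>"
    and "\<forall>V\<in>\<V>. openin (top_of_set S) V \<and> closedin (top_of_set S) V"
  shows "\<exists>\<delta>>0. \<forall>x\<in>S. \<forall>y\<in>S. dist x y \<le> \<delta> \<longrightarrow> {V \<in> \<V>. x \<in> V} = {V \<in> \<V>. y \<in> V}"
  using assms(2,3)
proof (induction \<V> rule: finite_induct)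
  case empty
  then show ?case
    by (intro exI[of _ 1]) simp
next
  case (insert W \<V>)
  then obtain \<delta> where \<delta>: "\<delta> > 0"
    "\<And>x y. x \<in> S \<Longrightarrow> y \<in> S \<Longrightarrow> dist x y \<le> \<delta> \<Longrightarrow> {V \<in> \<V>. x \<in> V} = {V \<in> \<V>. y \<in> V}"
    by auto
  obtain \<eta> where \<eta>: "\<eta> > 0" "\<And>x y. x \<in> S \<Longrightarrow> y \<in> S \<Longrightarrow> dist x y \<le> \<eta> \<Longrightarrow> (x \<in> W \<longleftrightarrow> y \<in> W)"
    using clopen_locally_constant[OF assms(1), of W] insert.prems by auto
  have insert_eq: "{V \<in> insert W \<V>. x \<in> V} = (if x \<in> W then insert W {V \<in> \<V>. x \<in> V} else {V \<in> \<V>. x \<in> V})"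
    for x
    by auto
  have "{V \<in> insert W \<V>. x \<in> V} = {V \<in> insert W \<V>. y \<in> V}"
    if "x \<in> S" "y \<in> S" "dist x y \<le> min \<delta> \<eta>" for x y
  proof -
    have "dist x y \<le> \<delta>" "dist x y \<le> \<eta>"
      using that(3) by simp_all
    then show ?thesis
      unfolding insert_eq using \<delta>(2)[OF that(1,2)] \<eta>(2)[OF that(1,2)] by (simp only:)
  qed
  moreover have "min \<delta> \<eta> > 0"
    using \<delta>(1) \<eta>(1) by simp
  ultimately show ?case
    by blast
qed

lemma zero_dimensional_fine_cover:
  fixes S :: "'a::metric_space set"
  assumes "compact S" "zero_dimensional S" "\<epsilon> > 0"
  shows "\<exists>\<V>. finite \<V> \<and> (\<forall>V\<in>\<V>. openin (top_of_set S) V \<and> closedin (top_of_set S) V) \<and>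
           S \<subseteq> \<Union>\<V> \<and> (\<forall>V\<in>\<V>. \<forall>x\<in>V. \<forall>y\<in>V. dist x y \<le> \<epsilon>)"
proof -
  define \<B> where "\<B> = {V. openin (top_of_set S) V \<and> closedin (top_of_set S) V \<and>
    (\<forall>x\<in>V. \<forall>y\<in>V. dist x y \<le> \<epsilon>)}"
  have "S \<subseteq> \<Union>\<B>"
  proof
    fix x assume "x \<in> S"
    then have "openin (top_of_set S) (S \<inter> ball x (\<epsilon> / 2))" "x \<in> S \<inter> ball x (\<epsilon> / 2)"
      using \<open>\<epsilon> > 0\<close> by (auto intro: openin_open_Int)
    then obtain V where V: "openin (top_of_set S) V" "closedin (top_of_set S) V" "x \<in> V"
      "V \<subseteq> S \<inter> ball x (\<epsilon> / 2)"
      using assms(2) \<open>x \<in> S\<close> unfolding zero_dimensional_def by blast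
    have "dist y z \<le> \<epsilon>" if "y \<in> V" "z \<in> V" for y z
    proof -
      have "dist x y < \<epsilon> / 2" "dist x z < \<epsilon> / 2"
        using V(4) that by auto
      then show ?thesis
        using dist_triangle3[of y z x] by simp
    qed
    with V show "x \<in> \<Union>\<B>"
      by (auto simp: \<B>_def)
  qed
  moreover have "\<forall>V\<in>\<B>. openin (top_of_set S) V"
    by (simp add: \<B>_def)
  ultimately obtain \<V> where "\<V> \<subseteq> \<B>" "finite \<V>" "S \<subseteq> \<Union>\<V>"
    using assms(1) unfolding compact_eq_openin_cover by meson
  then show ?thesis
    by (intro exI[of _ \<V>]) (auto simp: \<B>_def)
qed

text \<open>A precision \<open>\<eta>\<close> that determines the \<open>\<V>\<close>-labels is fed
  into shadowing, which returns \<open>\<delta>\<close>; adding a clopen cover by sets of diameter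
  at most \<open>min \<epsilon> \<delta>\<close> to \<open>\<V>\<close> gives \<open>\<W>\<close>.
  The sets may overlap: the partition is by the collection of members containing a point.\<close>

lemma shadowing_refinement:
  fixes S :: "'a::metric_space set"
  assumes S: "compact S" and f: "f ` S \<subseteq> S" and "shadowing S f" "zero_dimensional S"
    and \<V>: "finite \<V>" "\<forall>V\<in>\<V>. openin (top_of_set S) V \<and> closedin (top_of_set S) V"
    and "\<epsilon> > 0"
  shows "\<exists>\<W>. finite \<W> \<and> (\<forall>V\<in>\<W>. openin (top_of_set S) V \<and> closedin (top_of_set S) V) \<and> \<V> \<subseteq> \<W> \<and>
    (\<forall>x\<in>S. \<forall>y\<in>S. {V \<in> \<W>. x \<in> V} = {V \<in> \<W>. y \<in> V} \<longrightarrow> dist x y \<le> \<epsilon>) \<and>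
    (\<forall>xs. (\<forall>i. xs i \<in> S) \<and> (\<forall>i. {V \<in> \<W>. f (xs i) \<in> V} = {V \<in> \<W>. xs (Suc i) \<in> V}) \<longrightarrow>
      (\<exists>z\<in>S. \<forall>i. {V \<in> \<V>. (f ^^ i) z \<in> V} = {V \<in> \<V>. xs i \<in> V}))"
proof -
  obtain \<eta> where \<eta>: "\<eta> > 0"
    "\<And>x y. x \<in> S \<Longrightarrow> y \<in> S \<Longrightarrow> dist x y \<le> \<eta> \<Longrightarrow> {V \<in> \<V>. x \<in> V} = {V \<in> \<V>. y \<in> V}"
    using finite_clopen_locally_constant[OF S \<V>] by blast
  obtain \<delta> where "\<delta> > 0" and \<delta>: "\<And>xs. (\<forall>i. xs i \<in> S) \<Longrightarrow> (\<forall>i. dist (f (xs i)) (xs (Suc i)) \<le> \<delta>) \<Longrightarrow>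
      \<exists>x\<in>S. \<forall>i. dist ((f ^^ i) x) (xs i) \<le> \<eta>"
    using \<open>shadowing S f\<close> \<eta>(1) unfolding shadowing_def by meson
  obtain \<U> where \<U>: "finite \<U>" "\<forall>V\<in>\<U>. openin (top_of_set S) V \<and> closedin (top_of_set S) V"
    "S \<subseteq> \<Union>\<U>" "\<forall>V\<in>\<U>. \<forall>x\<in>V. \<forall>y\<in>V. dist x y \<le> min \<epsilon> \<delta>"
    using zero_dimensional_fine_cover[OF S \<open>zero_dimensional S\<close>, of "min \<epsilon> \<delta>"] \<open>\<epsilon> > 0\<close> \<open>\<delta> > 0\<close>
    by auto
  define \<W> where "\<W> = \<V> \<union> \<U>"
  have fine: "dist x y \<le> min \<epsilon> \<delta>" if xy: "x \<in> S" "{V \<in> \<W>. x \<in> V} = {V \<in> \<W>. y \<in> V}" for x y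
  proof -
    obtain V where "V \<in> \<U>" "x \<in> V"
      using \<U>(3) xy(1) by blast
    moreover from this have "y \<in> V"
      using xy(2) by (auto simp: \<W>_def)
    ultimately show ?thesis
      using \<U>(4) by blast
  qed
  have f_in: "(f ^^ i) z \<in> S" if "z \<in> S" for i z
    using that f by (induction i) auto
  have "\<exists>z\<in>S. \<forall>i. {V \<in> \<V>. (f ^^ i) z \<in> V} = {V \<in> \<V>. xs i \<in> V}"
    if xs: "\<forall>i. xs i \<in> S" "\<forall>i. {V \<in> \<W>. f (xs i) \<in> V} = {V \<in> \<W>. xs (Suc i) \<in> V}" for xs
  proof -
    have "dist (f (xs i)) (xs (Suc i)) \<le> min \<epsilon> \<delta>" for i
    proof (rule fine)
      show "f (xs i) \<in> S"
        using xs(1) f by blast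
      show "{V \<in> \<W>. f (xs i) \<in> V} = {V \<in> \<W>. xs (Suc i) \<in> V}"
        using xs(2) by blast
    qed
    then obtain z where "z \<in> S" "\<forall>i. dist ((f ^^ i) z) (xs i) \<le> \<eta>"
      using \<delta>[OF xs(1)] by auto
    then show ?thesis
      using \<eta>(2) f_in xs(1) by blast
  qed
  then show ?thesis
    using \<V> \<U>(1,2) fine by (intro exI[of _ \<W>]) (auto simp: \<W>_def)
qed

text \<open>The refinement is iterated with mesh bounds tending to 0. The families increase, so each
  label is cut out of the next one by intersection.\<close>

lemma exists_shadowing_partitions:
  fixes S :: "'a::metric_space set"
  assumes S: "compact S" and f: "f ` S \<subseteq> S" and "continuous_on S f"
    and "shadowing S f" "zero_dimensional S"
  shows "\<exists>p :: nat \<Rightarrow> 'a \<Rightarrow> 'a set set. shadowing_partitions S f p"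
proof -
  define label where "label \<V> x = {V \<in> \<V>. x \<in> V}" for \<V> and x :: 'a
  define P where "P n \<V> \<longleftrightarrow> finite \<V> \<and>
    (\<forall>V\<in>\<V>. openin (top_of_set S) V \<and> closedin (top_of_set S) V)" for n :: nat and \<V>
  define Q where "Q n \<V> \<W> \<longleftrightarrow> \<V> \<subseteq> \<W> \<and>
    (\<forall>x\<in>S. \<forall>y\<in>S. label \<W> x = label \<W> y \<longrightarrow> dist x y \<le> inverse (real (Suc n))) \<and>
    (\<forall>xs. (\<forall>i. xs i \<in> S) \<and> (\<forall>i. label \<W> (f (xs i)) = label \<W> (xs (Suc i))) \<longrightarrow>
      (\<exists>z\<in>S. \<forall>i. label \<V> ((f ^^ i) z) = label \<V> (xs i)))" for n \<V> \<W>
  \<comment> \<open>The empty family gives all points the same label.\<close>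
  have "\<exists>\<V>. P 0 \<V>"
    by (intro exI[of _ "{}"]) (simp add: P_def)
  moreover have "\<exists>\<W>. P (Suc n) \<W> \<and> Q n \<V> \<W>" if "P n \<V>" for n \<V>
    using shadowing_refinement[OF S f assms(4,5), of \<V> "inverse (real (Suc n))"] that
    unfolding P_def Q_def label_def by (simp del: of_nat_Suc)
  ultimately obtain \<V> where \<V>: "\<And>n. P n (\<V> n)" "\<And>n. Q n (\<V> n) (\<V> (Suc n))"
    using dependent_nat_choice[of P Q] by blast
  have "shadowing_partitions S f (\<lambda>n. label (\<V> n))"
  proof
    show "finite (label (\<V> n) ` S)" for n
      by (rule finite_subset[of _ "Pow (\<V> n)"]) (use \<V>(1) in \<open>auto simp: label_def P_def\<close>)
    show "label (\<V> n) x = label (\<V> n) y" if "label (\<V> (Suc n)) x = label (\<V> (Suc n)) y" for n x y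
    proof -
      have "label (\<V> n) z = \<V> n \<inter> label (\<V> (Suc n)) z" for z
        using \<V>(2)[of n] by (auto simp: label_def Q_def)
      then show ?thesis
        using that by simp
    qed
    show "\<exists>\<delta>>0. \<forall>x\<in>S. \<forall>y\<in>S. dist x y \<le> \<delta> \<longrightarrow> label (\<V> n) x = label (\<V> n) y" for n
      unfolding label_def using \<V>(1)[of n] by (intro finite_clopen_locally_constant[OF S]) (auto simp: P_def)
    show "\<exists>n. \<forall>x\<in>S. \<forall>y\<in>S. label (\<V> n) x = label (\<V> n) y \<longrightarrow> dist x y \<le> \<epsilon>" if "\<epsilon> > 0" for \<epsilon> :: real
    proof -
      obtain n where "inverse (real (Suc n)) < \<epsilon>"
        using reals_Archimedean[OF \<open>\<epsilon> > 0\<close>] by blast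
      \<comment> \<open>The mesh bound in \<open>Q n\<close> concerns the family with index
        \<open>Suc n\<close>.\<close>
      then show ?thesis
        using \<V>(2)[of n] unfolding Q_def by (intro exI[of _ "Suc n"]) (meson less_imp_le order_trans)
    qed
    show "\<exists>z\<in>S. \<forall>i. label (\<V> n) ((f ^^ i) z) = label (\<V> n) (xs i)"
      if "\<forall>i. xs i \<in> S" "\<forall>i. label (\<V> (Suc n)) (f (xs i)) = label (\<V> (Suc n)) (xs (Suc i))" for xs n
      using \<V>(2)[of n] that unfolding Q_def by blast
  qed fact+
  then show ?thesis
    by blast
qed

theorem theorem6p1:
  fixes S :: "'a::metric_space set" and f :: "'a \<Rightarrow> 'a"
  assumes "compact S"
    and "f ` S \<subseteq> S"
    and "continuous_on S f"
    and "shadowing S f"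
    and "zero_dimensional S"
  shows "chain_components S f =
           chain_components_topology S f closure_of shadowing_components S f"
proof -
  obtain p :: "nat \<Rightarrow> 'a \<Rightarrow> 'a set set" where "shadowing_partitions S f p"
    using exists_shadowing_partitions[OF assms] by blast
  then interpret shadowing_partitions S f p .
  show ?thesis
    by (rule shadowing_components_dense[symmetric])
qed

end
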